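(* Let $X$ be a set and let $\psi\in\mathcal{M}(X)$ be a multiset of size $L=\|\psi\|>0$. Then for any natural number $K\geq 0$, $$\sum_{\varphi\in\mathcal{M}[K](\mathrm{supp}(\psi))}\left(\!\binom{\psi}{\varphi}\!\right)=\left(\!\binom{L}{K}\!\right).$$
   Context: A multiset over a set $X$ is a function $\varphi\colon X\to\mathbb{N}$ with finite support $\mathrm{supp}(\varphi)=\{x\in X\mid \varphi(x)>0\}$; $\mathcal{M}(X)$ is the set of all multisets over $X$. The size of $\varphi$ is $\|\varphi\|=\sum_{x}\varphi(x)$, and $\mathcal{M}[K](X)=\{\varphi\in\mathcal{M}(X)\mid \|\varphi\|=K\}$. For natural numbers $n\geq 1$, $m\geq 0$ the multichoose coefficient is $$\left(\!\binom{n}{m}\!\right)=\binom{n+m-1}{m}=\frac{(n+m-1)!}{m!\,(n-1)!}.$$ For multisets $\psi$ and $\varphi$ with $\mathrm{supp}(\varphi)\subseteq\mathrm{supp}(\psi)$ one defines $$\left(\!\binom{\psi}{\varphi}\!\right)=\prod_{x\in\mathrm{supp}(\psi)}\left(\!\binom{\psi(x)}{\varphi(x)}\!\right).$$ Here an element of $\mathcal{M}[K](\mathrm{supp}(\psi))$ is regarded as a multiset over $X$ that is zero outside $\mathrm{supp}(\psi)$. *)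

theory Defs
  imports "HOL-Library.Multiset"
begin

(* Intended for n \<ge> 1 only; there the truncated subtraction on nat is exact. *)
definition multichoose :: "nat \<Rightarrow> nat \<Rightarrow> nat" where
  "multichoose n m = (n + m - 1) choose m"

(* Intended for set_mset \<phi> \<subseteq> set_mset \<psi> only; otherwise elements of \<phi> outside the
   support of \<psi> are silently ignored. *)
definition multichoose_mset :: "'a multiset \<Rightarrow> 'a multiset \<Rightarrow> nat" where
  "multichoose_mset \<psi> \<phi> = (\<Prod>x\<in>set_mset \<psi>. multichoose (count \<psi> x) (count \<phi> x))"

end

theory Submission
  imports Defs
begin

(* multichoose n m is the coefficient of t^m in (1 - t)^(-n), also for n = 0, where the
   truncated subtraction happens to give 1 for m = 0 and 0 otherwise. The theorem compares
   coefficients in the product of (1 - t)^(-psi x) over x in the support of psi. *)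

lemma multichoose_0_right [simp]: "multichoose n 0 = 1"
  by (simp add: multichoose_def)

lemma multichoose_0_Suc [simp]: "multichoose 0 (Suc m) = 0"
  by (simp add: multichoose_def)

text \<open>Pascal's rule; in generating functions,
  \<open>(1 - t)^(-n-1) = (1 - t)^(-n) + t (1 - t)^(-n-1)\<close>. No truncation occurs, even for
  \<open>n = 0\<close>, since each term has a successor argument or \<open>Suc n\<close>.\<close>

lemma multichoose_Suc_Suc:
  "multichoose (Suc n) (Suc m) = multichoose n (Suc m) + multichoose (Suc n) m"
  by (simp add: multichoose_def)

text \<open>The analogue of Vandermonde's identity: the coefficient of \<open>t^k\<close> in
  \<open>(1 - t)^(-m) (1 - t)^(-n)\<close>.\<close>

lemma sum_multichoose_mult:
  "(\<Sum>i\<le>k. multichoose m i * multichoose n (k - i)) = multichoose (m + n) k"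
proof (induction m arbitrary: k)
  case 0
  show ?case
  proof (cases k)
    case (Suc l)
    then show ?thesis
      unfolding Suc sum.atMost_Suc_shift by simp
  qed simp
next
  case (Suc m)
  note outer = Suc.IH
  show ?case
  proof (induction k)
    case (Suc k)
    \<comment> \<open>Pascal's rule applies to the terms with \<open>i > 0\<close>. The term
      \<open>i = 0\<close> does not depend on \<open>m\<close> and completes the first sum, which
      falls to the outer hypothesis at \<open>Suc k\<close>; the second falls to the inner one at
      \<open>k\<close>.\<close>
    have "(\<Sum>i\<le>Suc k. multichoose (Suc m) i * multichoose n (Suc k - i))
        = (\<Sum>i\<le>Suc k. multichoose m i * multichoose n (Suc k - i))
          + (\<Sum>i\<le>k. multichoose (Suc m) i * multichoose n (k - i))"
      unfolding sum.atMost_Suc_shift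
      by (simp add: multichoose_Suc_Suc add_mult_distrib sum.distrib)
    also have "\<dots> = multichoose (m + n) (Suc k) + multichoose (Suc m + n) k"
      using outer Suc.IH by simp
    finally show ?case
      by (simp add: multichoose_Suc_Suc)
  qed simp
qed

text \<open>Weights \<open>f\<close> independent of \<open>A\<close> let the induction shrink the
  index set while the weights stay fixed.\<close>

lemma sum_prod_multichoose:
  assumes "finite A"
  shows "(\<Sum>\<phi>\<in>multisets_of_size A k. \<Prod>x\<in>A. multichoose (f x) (count \<phi> x))
       = multichoose (sum f A) k"
  using assms
proof (induction A arbitrary: k)
  case empty
  then show ?case
    by (cases k) auto
next
  case (insert a A)
  let ?w = "\<lambda>B \<phi>. \<Prod>x\<in>B. multichoose (f x) (count \<phi> x)"
  have split: "?w (insert a A) (\<phi> + replicate_mset i a) = multichoose (f a) i * ?w A \<phi>"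
    if "\<phi> \<in> multisets_of_size A (k - i)" for \<phi> i
  proof -
    have "count \<phi> a = 0"
      using that insert.hyps by (auto simp: multisets_of_size_def count_eq_zero_iff)
    moreover have "?w A (\<phi> + replicate_mset i a) = ?w A \<phi>"
      using insert.hyps by (intro prod.cong) auto
    ultimately show ?thesis
      using insert.hyps by simp
  qed
  \<comment> \<open>A multiset over \<open>insert a A\<close> is sorted by the multiplicity
    \<open>i\<close> of \<open>a\<close>; the rest is a multiset of size \<open>k - i\<close> over
    \<open>A\<close>.\<close>
  have "(\<Sum>\<phi>\<in>multisets_of_size (insert a A) k. ?w (insert a A) \<phi>)
      = (\<Sum>(i, \<phi>)\<in>(SIGMA i:{0..k}. multisets_of_size A (k - i)).
           ?w (insert a A) (\<phi> + replicate_mset i a))"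
    using sum.reindex_bij_betw [OF bij_betw_multisets_of_size_insert [OF insert.hyps(2)],
        of "?w (insert a A)" k]
    by (simp add: case_prod_unfold)
  also have "\<dots> = (\<Sum>i\<le>k. \<Sum>\<phi>\<in>multisets_of_size A (k - i).
                      ?w (insert a A) (\<phi> + replicate_mset i a))"
    using insert.hyps by (subst sum.Sigma) (auto simp: atLeast0AtMost)
  also have "\<dots> = (\<Sum>i\<le>k. multichoose (f a) i * (\<Sum>\<phi>\<in>multisets_of_size A (k - i). ?w A \<phi>))"
    unfolding sum_distrib_left by (intro sum.cong refl split)
  also have "\<dots> = multichoose (f a + sum f A) k"
    by (simp add: insert.IH sum_multichoose_mult)
  finally show ?case
    using insert.hyps by simp
qed

theorem proposition2:
  fixes X :: "'a set" and \<psi> :: "'a multiset" and L K :: nat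
  assumes "set_mset \<psi> \<subseteq> X"
    and "L = size \<psi>"
    and "L > 0"
  shows "(\<Sum>\<phi>\<in>multisets_of_size (set_mset \<psi>) K. multichoose_mset \<psi> \<phi>) = multichoose L K"
  \<comment> \<open>The size of \<psi> becomes the sum of its counts over its support, so
    \<open>f\<close> is \<open>count \<psi>\<close>.\<close>
  unfolding multichoose_mset_def assms(2) size_multiset_overloaded_eq
  by (rule sum_prod_multichoose) simp

end
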